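(* Let $n\geq 3$ and $2\leq r\leq \binom{n}{2}$ be integers, and let $t=f(r)$ be the unique positive integer with $\binom{t}{2}+2\leq r\leq \binom{t+1}{2}+1$. Then the heterochromatic tree partition number of the complete graph $K_n$ satisfies $t_r(K_n)=\left\lceil \frac{n-t}{2}\right\rceil$.
   Context: An $r$-edge-coloring of a graph $G$ is an assignment of one of $r$ colors to each edge of $G$ such that each of the $r$ colors appears on at least one edge. A heterochromatic tree is an edge-colored tree in which any two edges have different colors; a tree consisting of a single vertex counts as a heterochromatic tree. For an $r$-edge-coloring $\phi$ of $G$, $t_r(G,\phi)$ is the minimum number of vertex-disjoint heterochromatic trees (in $G$ under $\phi$) needed to cover all vertices of $G$. The heterochromatic tree partition number is $t_r(G)=\max_\phi t_r(G,\phi)$, the maximum over all $r$-edge-colorings $\phi$ of $G$. For an integer $r\ge 2$, $f(r)$ denotes the unique positive integer $t$ with $\binom{t}{2}+2\leq r\leq \binom{t+1}{2}+1$. *)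

theory Defs
  imports Complex_Main
begin

record 'a ugraph =
  verts :: "'a set"
  edges :: "'a set set"

definition wf_graph :: "'a ugraph \<Rightarrow> bool" where
  "wf_graph G \<longleftrightarrow> (\<forall>e\<in>edges G. e \<subseteq> verts G \<and> card e = 2)"

definition complete_graph :: "'a set \<Rightarrow> 'a ugraph" where
  "complete_graph V = \<lparr>verts = V, edges = {e. e \<subseteq> V \<and> card e = 2}\<rparr>"

definition subgraph :: "'a ugraph \<Rightarrow> 'a ugraph \<Rightarrow> bool" where
  "subgraph H G \<longleftrightarrow> wf_graph H \<and> verts H \<subseteq> verts G \<and> edges H \<subseteq> edges G"

definition graph_connected :: "'a ugraph \<Rightarrow> bool" where
  "graph_connected G \<longleftrightarrow> verts G \<noteq> {} \<and>
     (\<forall>u\<in>verts G. \<forall>v\<in>verts G. (u, v) \<in> {(x, y). {x, y} \<in> edges G}\<^sup>*)"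

definition graph_cycle :: "'a ugraph \<Rightarrow> 'a list \<Rightarrow> bool" where
  "graph_cycle G p \<longleftrightarrow> 3 \<le> length p \<and> distinct p \<and>
     (\<forall>i<length p. {p ! i, p ! ((i + 1) mod length p)} \<in> edges G)"

definition is_tree :: "'a ugraph \<Rightarrow> bool" where
  "is_tree T \<longleftrightarrow> wf_graph T \<and> graph_connected T \<and> (\<nexists>p. graph_cycle T p)"

(* An edge coloring is only relevant on the edges of G; all r colors have to be used. *)
definition edge_coloring :: "nat \<Rightarrow> 'a ugraph \<Rightarrow> ('a set \<Rightarrow> nat) \<Rightarrow> bool" where
  "edge_coloring r G \<phi> \<longleftrightarrow> \<phi> ` edges G = {1..r}"

definition heterochromatic_tree :: "('a set \<Rightarrow> nat) \<Rightarrow> 'a ugraph \<Rightarrow> bool" where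
  "heterochromatic_tree \<phi> T \<longleftrightarrow> is_tree T \<and> inj_on \<phi> (edges T)"

definition heterochromatic_tree_partition ::
    "'a ugraph \<Rightarrow> ('a set \<Rightarrow> nat) \<Rightarrow> 'a ugraph set \<Rightarrow> bool" where
  "heterochromatic_tree_partition G \<phi> P \<longleftrightarrow>
     finite P \<and>
     (\<forall>T\<in>P. subgraph T G \<and> heterochromatic_tree \<phi> T) \<and>
     (\<forall>S\<in>P. \<forall>T\<in>P. S \<noteq> T \<longrightarrow> verts S \<inter> verts T = {}) \<and>
     (\<Union>T\<in>P. verts T) = verts G"

definition min_heterochromatic_trees :: "'a ugraph \<Rightarrow> ('a set \<Rightarrow> nat) \<Rightarrow> nat" where
  "min_heterochromatic_trees G \<phi> =
     (LEAST k. \<exists>P. heterochromatic_tree_partition G \<phi> P \<and> card P = k)"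

(* For a finite graph this is the maximum of a finite set: the partition of G into
   single vertices bounds every element by the number of vertices. *)
definition heterochromatic_tree_partition_number :: "nat \<Rightarrow> 'a ugraph \<Rightarrow> nat" where
  "heterochromatic_tree_partition_number r G =
     Max {min_heterochromatic_trees G \<phi> | \<phi>. edge_coloring r G \<phi>}"

definition f :: "nat \<Rightarrow> nat" where
  "f r = (THE t. 0 < t \<and> (t choose 2) + 2 \<le> r \<and> r \<le> ((t + 1) choose 2) + 1)"

end

(* Upper bound, by induction on the number of vertices, for colorings with at least
   binom(t,2) + 2 colors. Let T be a heterochromatic tree with as many vertices as possible,
   say k. If k >= t + 2, cover the remaining vertices by single edges. Otherwise, by maximality,
   the color of any edge leaving T is the color of some tree edge e. Let A and B be the sides
   of T - e. Exchanging e for another edge between A and B shows that all |A||B| >= k - 1 edges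
   between A and B have colors of T, so T spans at most binom(k-1,2) + 1 colors. Edges leaving T
   bring no further color, so the vertices outside T still span enough colors for the induction
   with t + 2 - k in place of t. The count is tight only for k = t + 1, where an exchange argument
   supplies the missing color.

   Lower bound: give the edges inside a set A of t + 1 vertices r - 1 colors and all other edges
   the color r. A heterochromatic tree has at most two vertices outside A, and at most one if it
   meets A. *)

theory Submission
  imports Defs
begin

section \<open>Trees built by joining two disjoint trees with an edge\<close>

text \<open>With joining as the constructor, deleting an edge and reconnecting the two sides by
  another one, the basic move of the upper bound, becomes an instance of
  \<open>join\<close>.\<close>

inductive tree_on :: "'a set \<Rightarrow> 'a set set \<Rightarrow> bool" where
  single: "tree_on {v} {}"
| join: "\<lbrakk>tree_on A E; tree_on B F; A \<inter> B = {}; a \<in> A; b \<in> B\<rbrakk>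
    \<Longrightarrow> tree_on (A \<union> B) (insert {a, b} (E \<union> F))"

lemma tree_on_edges:
  "tree_on S E \<Longrightarrow> finite S \<and> S \<noteq> {} \<and> (\<forall>e\<in>E. e \<subseteq> S \<and> card e = 2)"
proof (induction rule: tree_on.induct)
  case (join A E B F a b)
  then have "a \<noteq> b" by blast
  then show ?case using join by auto
qed auto

text \<open>The deleted edge need not be the one joined last: if it lies in one operand, that
  operand splits by induction, and the other operand is attached to the half containing the end of
  the joining edge.\<close>

lemma tree_on_split:
  assumes "tree_on S E" "e \<in> E"
  shows "\<exists>A B F G a b. tree_on A F \<and> tree_on B G \<and> A \<inter> B = {} \<and> S = A \<union> B \<and>
    a \<in> A \<and> b \<in> B \<and> e = {a, b} \<and> E = insert e (F \<union> G)"
  using assms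
proof (induction rule: tree_on.induct)
  case (single v)
  then show ?case by simp
next
  case (join A E B F a b)
  \<comment> \<open>Generic in both operands, so that it also serves the mirrored case
    \<open>e \<in> F\<close>.\<close>
  have glue: "\<exists>X Y H I x y. tree_on X H \<and> tree_on Y I \<and> X \<inter> Y = {} \<and> A' \<union> B' = X \<union> Y \<and>
      x \<in> X \<and> y \<in> Y \<and> e = {x, y} \<and> insert {a', b'} (E' \<union> F') = insert e (H \<union> I)"
    if IH: "\<exists>X Y H I x y. tree_on X H \<and> tree_on Y I \<and> X \<inter> Y = {} \<and> A' = X \<union> Y \<and>
        x \<in> X \<and> y \<in> Y \<and> e = {x, y} \<and> E' = insert e (H \<union> I)"
      and B': "tree_on B' F'" "A' \<inter> B' = {}" "a' \<in> A'" "b' \<in> B'"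
    for A' B' a' b' E' F'
  proof -
    obtain X Y H I x y where X: "tree_on X H" "tree_on Y I" "X \<inter> Y = {}" "A' = X \<union> Y"
      "x \<in> X" "y \<in> Y" "e = {x, y}" "E' = insert e (H \<union> I)"
      using IH by blast
    show ?thesis
    proof (cases "a' \<in> X")
      case True
      have "tree_on (X \<union> B') (insert {a', b'} (H \<union> F'))"
        using X B' True by (intro tree_on.join) auto
      moreover have "(X \<union> B') \<inter> Y = {}" "A' \<union> B' = (X \<union> B') \<union> Y" "x \<in> X \<union> B'"
        "insert {a', b'} (E' \<union> F') = insert e (insert {a', b'} (H \<union> F') \<union> I)"
        using X B' by auto
      ultimately show ?thesis using X(2,6,7) by blast
    next
      case False
      then have "a' \<in> Y" using X B' by auto
      then have "tree_on (Y \<union> B') (insert {a', b'} (I \<union> F'))"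
        using X B' by (intro tree_on.join) auto
      moreover have "X \<inter> (Y \<union> B') = {}" "A' \<union> B' = X \<union> (Y \<union> B')" "y \<in> Y \<union> B'"
        "insert {a', b'} (E' \<union> F') = insert e (H \<union> insert {a', b'} (I \<union> F'))"
        using X B' by auto
      ultimately show ?thesis using X(1,5,7) by blast
    qed
  qed
  consider "e = {a, b}" | "e \<in> E" | "e \<in> F" using join.prems by blast
  then show ?case
  proof cases
    case 1
    then show ?thesis using join.hyps by blast
  next
    case 2
    show ?thesis
      using glue[OF join.IH(1)[OF 2] join.hyps(2,3,4,5)] .
  next
    case 3
    have "B \<inter> A = {}" using join.hyps(3) by blast
    from glue[OF join.IH(2)[OF 3] join.hyps(1) this join.hyps(5,4)]
    show ?thesis by (simp only: Un_commute[of A B] Un_commute[of E F] insert_commute[of a b])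
  qed
qed

lemma tree_on_incident:
  assumes "tree_on S E" "v \<in> S" "2 \<le> card S"
  shows "\<exists>e\<in>E. v \<in> e"
  using assms
proof (induction arbitrary: v rule: tree_on.induct)
  case (single v)
  then show ?case by simp
next
  case (join A E B F a b)
  have *: "X = {x}" if "tree_on X H" "\<not> 2 \<le> card X" "x \<in> X" for X x and H :: "'a set set"
  proof -
    have "finite X" "X \<noteq> {}" using tree_on_edges that(1) by auto
    then have "0 < card X" by (simp add: card_gt_0_iff)
    then have "card X = 1" using that(2) by linarith
    then show ?thesis using that(3) by (auto simp: card_1_singleton_iff)
  qed
  consider "v \<in> A" | "v \<in> B" using join.prems by blast
  then show ?case
  proof cases
    case 1
    show ?thesis
    proof (cases "2 \<le> card A")
      case True
      then show ?thesis using join.IH(1)[OF 1] by blast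
    next
      case False
      then have "v = a" using *[OF join.hyps(1) False join.hyps(4)] 1 by simp
      then show ?thesis by simp
    qed
  next
    case 2
    show ?thesis
    proof (cases "2 \<le> card B")
      case True
      then show ?thesis using join.IH(2)[OF 2] by blast
    next
      case False
      then have "v = b" using *[OF join.hyps(2) False join.hyps(5)] 2 by simp
      then show ?thesis by simp
    qed
  qed
qed

text \<open>One operand of the last join has at least two vertices, so the end of the joining edge
  on that side has a further incident edge. Such a vertex keeps an incident edge whichever single
  edge is deleted.\<close>

lemma tree_on_branching:
  assumes "tree_on S E" "3 \<le> card S"
  shows "\<exists>w\<in>S. \<exists>e\<in>E. \<exists>e'\<in>E. e \<noteq> e' \<and> w \<in> e \<and> w \<in> e'"
  using assms(1)
proof cases
  case (single v)
  then show ?thesis using assms by simp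
next
  case (join A F B G a b)
  have "card S = card A + card B"
    using join tree_on_edges by (metis card_Un_disjoint)
  then consider "2 \<le> card A" | "2 \<le> card B" using assms(2) by linarith
  then show ?thesis
  proof cases
    case 1
    then obtain e where "e \<in> F" "a \<in> e" using tree_on_incident join by metis
    moreover from this have "e \<noteq> {a, b}" using tree_on_edges[OF join(3)] join by blast
    moreover have "a \<in> S" "{a, b} \<in> E" "F \<subseteq> E" using join(6) unfolding join(1,2) by auto
    ultimately show ?thesis
      by (intro bexI[of _ a] bexI[of _ e] bexI[of _ "{a, b}"]) auto
  next
    case 2
    then obtain e where "e \<in> G" "b \<in> e" using tree_on_incident join by metis
    moreover from this have "e \<noteq> {a, b}" using tree_on_edges[OF join(4)] join by blast
    moreover have "b \<in> S" "{a, b} \<in> E" "G \<subseteq> E" using join(7) unfolding join(1,2) by auto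
    ultimately show ?thesis
      by (intro bexI[of _ b] bexI[of _ e] bexI[of _ "{a, b}"]) auto
  qed
qed

text \<open>If \<open>P\<close> never switched off, it would propagate upwards from \<open>i\<close>
  to \<open>j + i * m\<close>, where by periodicity it agrees with \<open>P j\<close>.\<close>

lemma cyclic_transition:
  fixes P :: "nat \<Rightarrow> bool"
  assumes per: "\<And>i. P (i + m) = P i" and "0 < m" "P i" "\<not> P j"
  shows "\<exists>k. P k \<and> \<not> P (Suc k)"
proof (rule ccontr)
  assume "\<nexists>k. P k \<and> \<not> P (Suc k)"
  then have step: "P k \<Longrightarrow> P (Suc k)" for k by blast
  have "P (i + d)" for d by (induction d) (use assms(3) step in auto)
  moreover have "P (j + d * m) = P j" for d
  proof (induction d)
    case (Suc d)
    then show ?case using per[of "j + d * m"] by (simp add: ac_simps)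
  qed simp
  moreover have "i \<le> j + i * m" using \<open>0 < m\<close> by (cases m) auto
  ultimately show False using assms(4) by (metis le_add_diff_inverse)
qed

text \<open>A cycle meeting both operands must leave \<open>A\<close> and return to it, both times
  along the single edge \<open>{a, b}\<close>, which a cycle of length at least 3 cannot do. A cycle
  within one operand is excluded by induction.\<close>

lemma tree_on_no_cycle:
  assumes "tree_on S E"
  shows "\<not> graph_cycle \<lparr>verts = S, edges = E\<rparr> p"
  using assms
proof (induction rule: tree_on.induct)
  case (single v)
  show ?case
  proof
    assume c: "graph_cycle \<lparr>verts = {v}, edges = {}\<rparr> p"
    then have "3 \<le> length p" "\<forall>i. \<not> i < length p" by (auto simp: graph_cycle_def)
    then show False by (metis less_le_trans zero_less_numeral)
  qed
next
  case (join A E B F a b)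
  show ?case
  proof
    assume cyc: "graph_cycle \<lparr>verts = A \<union> B, edges = insert {a, b} (E \<union> F)\<rparr> p"
    define m where "m = length p"
    \<comment> \<open>The periodic extension of \<open>p\<close> treats the closing edge like all
      others.\<close>
    define q where "q i = p ! (i mod m)" for i
    have m: "3 \<le> m" "distinct p" using cyc by (auto simp: graph_cycle_def m_def)
    have E: "e \<subseteq> A" if "e \<in> E" for e using tree_on_edges[OF join.hyps(1)] that by blast
    have F: "e \<subseteq> B" if "e \<in> F" for e using tree_on_edges[OF join.hyps(2)] that by blast
    have edge: "{q i, q (Suc i)} \<in> insert {a, b} (E \<union> F)" for i
    proof -
      have "i mod m < m" using m by simp
      then have "{p ! (i mod m), p ! ((i mod m + 1) mod m)} \<in> insert {a, b} (E \<union> F)"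
        using cyc unfolding graph_cycle_def m_def by simp
      moreover have "(i mod m + 1) mod m = Suc i mod m" by (simp add: mod_simps)
      ultimately show ?thesis unfolding q_def by metis
    qed
    have inj: "i mod m = j mod m" if "q i = q j" for i j
      using that m nth_eq_iff_index_eq[of p "i mod m" "j mod m"] unfolding q_def m_def
      by (metis (no_types, lifting) gr0I mod_less_divisor not_numeral_le_zero)
    have per: "q (i + m) = q i" for i unfolding q_def by simp
    have sub: "q i \<in> A \<union> B" for i using edge[of i] E F join.hyps(4,5) by (metis (no_types) Un_iff insert_iff insert_subset singletonD)
    have q_nth: "i < m \<Longrightarrow> q i = p ! i \<and> q (Suc i) = p ! ((i + 1) mod m)" for i unfolding q_def by simp
    consider "\<forall>i. q i \<in> A" | "\<forall>i. q i \<notin> A" | i j where "q i \<in> A" "q j \<notin> A" by blast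
    then show False
    proof cases
      case 1
      have "{q i, q (Suc i)} \<in> E" for i
      proof -
        have "q i \<notin> B" "q (Suc i) \<notin> B" using 1 join.hyps(3) by blast+
        then have "{q i, q (Suc i)} \<noteq> {a, b}" "{q i, q (Suc i)} \<notin> F"
          using F join.hyps(5) by (metis insertI1 insert_iff singletonD) (use F \<open>q i \<notin> B\<close> in blast)
        then show ?thesis using edge[of i] by blast
      qed
      then have "graph_cycle \<lparr>verts = A, edges = E\<rparr> p"
        using m q_nth unfolding graph_cycle_def m_def by (metis select_convs(2))
      then show False using join.IH by blast
    next
      case 2
      have "{q i, q (Suc i)} \<in> F" for i
      proof -
        have "q i \<notin> A" "q (Suc i) \<notin> A" using 2 by blast+
        then have "{q i, q (Suc i)} \<noteq> {a, b}" "{q i, q (Suc i)} \<notin> E"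
          using join.hyps(4) by (metis insertI1 insert_iff singletonD) (use E \<open>q i \<notin> A\<close> in blast)
        then show ?thesis using edge[of i] by blast
      qed
      then have "graph_cycle \<lparr>verts = B, edges = F\<rparr> p"
        using m q_nth unfolding graph_cycle_def m_def by (metis select_convs(2))
      then show False using join.IH by blast
    next
      case (3 i j)
      have "\<exists>k. q k \<in> A \<and> q (Suc k) \<notin> A"
        using cyclic_transition[of "\<lambda>i. q i \<in> A" m i j] 3 m per by auto
      then obtain k where k: "q k \<in> A" "q (Suc k) \<notin> A" by blast
      have "\<exists>k. q k \<notin> A \<and> q (Suc k) \<in> A"
        using cyclic_transition[of "\<lambda>i. q i \<notin> A" m j i] 3 m per by auto
      then obtain l where l: "q l \<notin> A" "q (Suc l) \<in> A" by blast
      have bA: "b \<notin> A" using join.hyps by blast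
      have kB: "q (Suc k) \<in> B" "q l \<in> B" using sub k l by blast+
      have "{q k, q (Suc k)} = {a, b}"
        using edge[of k] E F k join.hyps(3) by blast
      then have k': "q k = a" "q (Suc k) = b" using k bA by (auto simp: doubleton_eq_iff)
      have "{q l, q (Suc l)} = {a, b}"
        using edge[of l] E F l join.hyps(3) by blast
      then have l': "q l = b" "q (Suc l) = a" using l bA join.hyps(4) by (auto simp: doubleton_eq_iff)
      \<comment> \<open>The edge is passed from \<open>a\<close> to \<open>b\<close> at
        \<open>k\<close> and from \<open>b\<close> to \<open>a\<close> at \<open>l\<close>; as
        vertices do not repeat, \<open>k\<close> and \<open>k + 2\<close> agree modulo
        \<open>m\<close>.\<close>
      have "Suc k mod m = l mod m" "k mod m = Suc l mod m" using inj k' l' by metis+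
      then have "k mod m = (k + 2) mod m" by (metis add_2_eq_Suc' mod_Suc_eq)
      then have "m dvd (k + 2) - k" using mod_eq_dvd_iff_nat[of k "k+2" m] by simp
      then have "m \<le> 2" using dvd_imp_le[of m 2] by simp
      then show False using m by simp
    qed
  qed
qed

lemma tree_on_connected:
  assumes "tree_on S E"
  shows "\<forall>u\<in>S. \<forall>v\<in>S. (u, v) \<in> {(x, y). {x, y} \<in> E}\<^sup>*"
  using assms
proof (induction rule: tree_on.induct)
  case (single v)
  then show ?case by simp
next
  case (join A E B F a b)
  let ?R = "{(x, y). {x, y} \<in> insert {a, b} (E \<union> F)}"
  have A: "(u, v) \<in> ?R\<^sup>*" if "u \<in> A" "v \<in> A" for u v
    using join.IH(1) that rtrancl_mono[of "{(x, y). {x, y} \<in> E}" ?R] by blast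
  have B: "(u, v) \<in> ?R\<^sup>*" if "u \<in> B" "v \<in> B" for u v
    using join.IH(2) that rtrancl_mono[of "{(x, y). {x, y} \<in> F}" ?R] by blast
  have ab: "(a, b) \<in> ?R" "(b, a) \<in> ?R" by (auto simp: insert_commute)
  show ?case
    using A B ab join.hyps(4,5)
    by (metis (no_types, lifting) Un_iff rtrancl.rtrancl_into_rtrancl rtrancl_trans)
qed

lemma tree_on_is_tree:
  assumes "tree_on S E"
  shows "is_tree \<lparr>verts = S, edges = E\<rparr>"
  using tree_on_edges[OF assms] tree_on_connected[OF assms] tree_on_no_cycle[OF assms]
  by (simp add: is_tree_def wf_graph_def graph_connected_def)

section \<open>Assembling partitions of complete graphs\<close>

lemma edges_complete_graph [simp]: "edges (complete_graph V) = {e. e \<subseteq> V \<and> card e = 2}"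
  and verts_complete_graph [simp]: "verts (complete_graph V) = V"
  by (simp_all add: complete_graph_def)

lemma inj_on_insertI: "inj_on g A \<Longrightarrow> g a \<notin> g ` A \<Longrightarrow> inj_on g (insert a A)"
  by (auto simp: inj_on_insert)

lemma two_distinct_elements:
  assumes "2 \<le> card X"
  obtains c d where "c \<in> X" "d \<in> X" "c \<noteq> d"
proof -
  have "finite X" using assms by (intro card_ge_0_finite) simp
  moreover have "\<not> card X \<le> Suc 0" using assms by simp
  ultimately show ?thesis using card_le_Suc0_iff_eq[of X] that by blast
qed

definition rainbow_tree :: "('a set \<Rightarrow> nat) \<Rightarrow> 'a set \<Rightarrow> 'a set set \<Rightarrow> bool" where
  "rainbow_tree \<phi> S E \<longleftrightarrow> tree_on S E \<and> inj_on \<phi> E"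

lemma partition_single:
  assumes "rainbow_tree \<phi> S E"
  shows "heterochromatic_tree_partition (complete_graph S) \<phi> {\<lparr>verts = S, edges = E\<rparr>}"
  using assms tree_on_is_tree[of S E] tree_on_edges[of S E]
  by (auto simp: heterochromatic_tree_partition_def subgraph_def heterochromatic_tree_def
      rainbow_tree_def wf_graph_def)

lemma partition_Un:
  assumes "heterochromatic_tree_partition (complete_graph V) \<phi> P"
    and "heterochromatic_tree_partition (complete_graph W) \<phi> Q" and "V \<inter> W = {}"
  shows "heterochromatic_tree_partition (complete_graph (V \<union> W)) \<phi> (P \<union> Q)"
proof -
  have P: "finite P" "(\<Union>T\<in>P. verts T) = V" "\<forall>S\<in>P. \<forall>T\<in>P. S \<noteq> T \<longrightarrow> verts S \<inter> verts T = {}"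
    "\<forall>T\<in>P. subgraph T (complete_graph V) \<and> heterochromatic_tree \<phi> T"
    using assms(1) by (simp_all add: heterochromatic_tree_partition_def)
  have Q: "finite Q" "(\<Union>T\<in>Q. verts T) = W" "\<forall>S\<in>Q. \<forall>T\<in>Q. S \<noteq> T \<longrightarrow> verts S \<inter> verts T = {}"
    "\<forall>T\<in>Q. subgraph T (complete_graph W) \<and> heterochromatic_tree \<phi> T"
    using assms(2) by (simp_all add: heterochromatic_tree_partition_def)
  have "verts S \<inter> verts T = {}" if "S \<in> P" "T \<in> Q" for S T
    using that P(2) Q(2) assms(3) by blast
  moreover have "subgraph T (complete_graph (V \<union> W))" if "T \<in> P \<union> Q" for T
    using that P(4) Q(4) by (auto simp: subgraph_def)
  ultimately show ?thesis
    using P Q unfolding heterochromatic_tree_partition_def by (simp add: Int_commute ball_Un) blast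
qed

lemma rainbow_tree_pair:
  assumes "a \<noteq> b"
  shows "rainbow_tree \<phi> {a, b} {{a, b}}"
  using tree_on.join[OF tree_on.single[of a] tree_on.single[of b], of a b] assms
  by (simp add: rainbow_tree_def insert_commute)

text \<open>Vertices are removed two at a time. The sharper even case gives the empty partition when
  \<open>W\<close> is empty, which is what a spanning tree in the upper bound requires.\<close>

lemma partition_pairs:
  assumes "finite W"
  shows "\<exists>P. heterochromatic_tree_partition (complete_graph W) \<phi> P \<and> 2 * card P \<le> card W + 1 \<and>
    (even (card W) \<longrightarrow> 2 * card P \<le> card W)"
  using assms
proof (induction "card W" arbitrary: W rule: less_induct)
  case less
  consider "W = {}" | v where "W = {v}" | a b where "a \<in> W" "b \<in> W" "a \<noteq> b" by blast
  then show ?case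
  proof cases
    case 1
    then have "heterochromatic_tree_partition (complete_graph W) \<phi> {}"
      by (simp add: heterochromatic_tree_partition_def)
    then show ?thesis using 1 by (intro exI[of _ "{}"]) simp
  next
    case (2 v)
    have "rainbow_tree \<phi> {v} {}" by (simp add: rainbow_tree_def tree_on.single)
    from partition_single[OF this] show ?thesis unfolding 2 by (intro exI conjI) auto
  next
    case (3 a b)
    have W: "card W = card (W - {a, b}) + 2" "W = {a, b} \<union> (W - {a, b})"
      using 3 less.prems card_mono[of W "{a, b}"] by (auto simp: card_Diff_subset)
    then obtain P where P: "heterochromatic_tree_partition (complete_graph (W - {a, b})) \<phi> P"
      "2 * card P \<le> card (W - {a, b}) + 1"
      "even (card (W - {a, b})) \<longrightarrow> 2 * card P \<le> card (W - {a, b})"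
      using less.hyps[of "W - {a, b}"] less.prems by auto
    let ?T = "\<lparr>verts = {a, b}, edges = {{a, b}}\<rparr>"
    have "heterochromatic_tree_partition (complete_graph W) \<phi> ({?T} \<union> P)"
      using partition_Un[OF partition_single[OF rainbow_tree_pair[OF 3(3)]] P(1)] W(2) by auto
    moreover have "card ({?T} \<union> P) \<le> card P + 1" using card_Un_le[of "{?T}" P] by simp
    ultimately show ?thesis using P(2,3) W(1) by (intro exI conjI) auto
  qed
qed

section \<open>Counting pairs, and rainbow trees on three vertices\<close>

text \<open>Pairs in a disjoint union lie in one part or cross between the parts.\<close>

lemma choose_two_add: "(a + b) choose 2 = (a choose 2) + (b choose 2) + a * b"
  by (induction b) (simp_all add: numeral_2_eq_2 algebra_simps)

lemma choose_two_pred: "0 < n \<Longrightarrow> n choose 2 = ((n - 1) choose 2) + (n - 1)"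
  by (cases n) (simp_all add: numeral_2_eq_2)

lemma one_choose_two: "Suc 0 choose 2 = 0"
  by (simp add: numeral_2_eq_2)

lemma choose_two_mono: "m \<le> n \<Longrightarrow> m choose 2 \<le> n choose 2"
  by (metis choose_two_add le_Suc_ex le_add1 add.assoc)

text \<open>Two edges with a common end form the path themselves. For disjoint edges, an edge
  between them differs in color from at least one of the two and extends it.\<close>

lemma rainbow_tree_three:
  assumes "e \<subseteq> W" "card e = 2" "e' \<subseteq> W" "card e' = 2" "\<phi> e \<noteq> \<phi> e'"
  shows "\<exists>S E. rainbow_tree \<phi> S E \<and> S \<subseteq> W \<and> 3 \<le> card S"
proof -
  have path: "\<exists>S E. rainbow_tree \<phi> S E \<and> S \<subseteq> W \<and> 3 \<le> card S"
    if "a \<in> W" "b \<in> W" "c \<in> W" "a \<noteq> b" "b \<noteq> c" "a \<noteq> c" "\<phi> {a, b} \<noteq> \<phi> {b, c}" for a b c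
  proof -
    have "tree_on ({a, b} \<union> {c}) (insert {b, c} ({{a, b}} \<union> {}))"
      using rainbow_tree_pair[of a b] that
      by (intro tree_on.join tree_on.single) (auto simp: rainbow_tree_def)
    moreover have "inj_on \<phi> (insert {b, c} ({{a, b}} \<union> {}))" using that by auto
    moreover have "card ({a, b} \<union> {c}) = 3" "{a, b} \<union> {c} \<subseteq> W" using that by auto
    ultimately show ?thesis unfolding rainbow_tree_def by (metis order_refl)
  qed
  obtain a b where e: "e = {a, b}" "a \<noteq> b" using assms(2) by (auto simp: card_2_iff)
  obtain c d where e': "e' = {c, d}" "c \<noteq> d" using assms(4) by (auto simp: card_2_iff)
  have W: "a \<in> W" "b \<in> W" "c \<in> W" "d \<in> W" using assms e e' by auto
  consider "b = c" | "a = c" | "b = d" | "a = d" | "b \<noteq> c \<and> a \<noteq> c \<and> b \<noteq> d" by blast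
  then show ?thesis
  proof cases
    case 1
    then show ?thesis using path[of a b d] e e' W assms(5) by (metis insert_commute)
  next
    case 2
    then show ?thesis using path[of b a d] e e' W assms(5) by (metis insert_commute)
  next
    case 3
    then show ?thesis using path[of a b c] e e' W assms(5) by (metis insert_commute)
  next
    case 4
    then show ?thesis using path[of b a c] e e' W assms(5) by (metis insert_commute)
  next
    case 5
    show ?thesis
    proof (cases "\<phi> {b, c} = \<phi> {a, b}")
      case True
      then have "\<phi> {b, c} \<noteq> \<phi> {c, d}" using assms(5) e e' by simp
      then show ?thesis using path[of b c d] 5 W e e' by blast
    next
      case False
      then show ?thesis using path[of a b c] 5 W e e' by metis
    qed
  qed
qed

text \<open>Both parts rest on x*y + 1 - x - y = (x - 1)*(y - 1). For the side sizes of a split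
  tree, the second part detects that the deleted edge is pendant.\<close>

lemma sum_le_Suc_prod:
  fixes x y :: nat
  assumes "1 \<le> x" "1 \<le> y"
  shows "x + y \<le> x * y + 1" and "2 \<le> x \<Longrightarrow> x * y \<le> x + y - 1 \<Longrightarrow> y = 1"
proof -
  obtain x' y' where xy: "x = Suc x'" "y = Suc y'" using assms by (metis Suc_le_D One_nat_def)
  show "x + y \<le> x * y + 1" unfolding xy by simp
  show "y = 1" if "2 \<le> x" "x * y \<le> x + y - 1"
    using that unfolding xy by auto
qed

section \<open>Rainbow trees with the most vertices\<close>

text \<open>Maximality is by number of vertices rather than by inclusion, because the exchange
  arguments also discard edges and vertices of the tree.\<close>

locale maximal_rainbow_tree =
  fixes \<phi> :: "'a set \<Rightarrow> nat" and W S :: "'a set" and E :: "'a set set"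
  assumes fin: "finite W" and tree: "rainbow_tree \<phi> S E" and SW: "S \<subseteq> W"
    and maximal: "\<And>S' E'. rainbow_tree \<phi> S' E' \<Longrightarrow> S' \<subseteq> W \<Longrightarrow> card S' \<le> card S"
begin

lemma finS: "finite S"
  using fin SW finite_subset by blast

lemma leaving_color:
  assumes "w \<in> S" "u \<in> W - S"
  shows "\<phi> {w, u} \<in> \<phi> ` E"
proof (rule ccontr)
  assume new: "\<phi> {w, u} \<notin> \<phi> ` E"
  have "tree_on (S \<union> {u}) (insert {w, u} (E \<union> {}))"
    using tree assms by (intro tree_on.join tree_on.single) (auto simp: rainbow_tree_def)
  moreover have "inj_on \<phi> (insert {w, u} (E \<union> {}))"
    using new tree by (auto simp: rainbow_tree_def)
  ultimately have "card (S \<union> {u}) \<le> card S"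
    using maximal[of "S \<union> {u}"] assms SW unfolding rainbow_tree_def by auto
  then show False using assms finS by simp
qed

lemma split_at_leaving_edge:
  assumes w: "w \<in> S" and u: "u \<in> W - S"
  obtains A B F G where "tree_on A F" "tree_on B G" "A \<inter> B = {}" "S = A \<union> B" "w \<in> A"
    "inj_on \<phi> F" "\<phi> {w, u} \<notin> \<phi> ` F" "\<exists>e. E = insert e (F \<union> G)"
    "card (\<phi> ` edges (complete_graph S)) + card A * card B \<le> (card S choose 2) + 1"
proof -
  obtain e where e: "e \<in> E" "\<phi> e = \<phi> {w, u}" using leaving_color[OF w u] by force
  have E: "tree_on S E" "inj_on \<phi> E" using tree by (auto simp: rainbow_tree_def)
  \<comment> \<open>The sides are swapped if necessary to put \<open>w\<close> into
    \<open>A\<close>.\<close>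
  obtain A B F G a b where sp: "tree_on A F" "tree_on B G" "A \<inter> B = {}" "S = A \<union> B" "w \<in> A"
    "(a \<in> A \<and> b \<in> B)" "e = {a, b}" "E = insert e (F \<union> G)"
  proof -
    obtain A B F G a b where sp: "tree_on A F" "tree_on B G" "A \<inter> B = {}" "S = A \<union> B"
      "a \<in> A" "b \<in> B" "e = {a, b}" "E = insert e (F \<union> G)"
      using tree_on_split[OF E(1) e(1)] by blast
    show ?thesis
    proof (cases "w \<in> A")
      case True
      then show ?thesis using that sp by blast
    next
      case False
      then have "w \<in> B" using w sp by blast
      moreover have "E = insert e (G \<union> F)" "e = {b, a}" "B \<inter> A = {}" "S = B \<union> A" using sp by auto
      ultimately show ?thesis using that[of B G A F b a] sp by blast
    qed
  qed
  have fA: "finite A" "finite B" "A \<noteq> {}" "B \<noteq> {}"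
    and FA: "\<forall>e\<in>F. e \<subseteq> A \<and> card e = 2" and GB: "\<forall>e\<in>G. e \<subseteq> B \<and> card e = 2"
    using tree_on_edges[OF sp(1)] tree_on_edges[OF sp(2)] by auto
  have "e \<notin> F" using FA sp by blast
  moreover have "e \<notin> G" using GB sp by blast
  ultimately have "e \<notin> F \<union> G" by blast
  \<comment> \<open>Deleting \<open>e\<close> frees its color for \<open>{w, u}\<close>.\<close>
  then have cFG: "\<phi> {w, u} \<notin> \<phi> ` (F \<union> G)" and iFG: "inj_on \<phi> (F \<union> G)"
    using E(2) e(2) sp(8) by (auto simp: inj_on_def)
  define X where "X = (\<lambda>(x, y). {x, y}) ` (A \<times> B)"
  have "inj_on (\<lambda>(x, y). {x, y}) (A \<times> B)"
    using sp(3) by (auto simp: inj_on_def doubleton_eq_iff)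
  then have cX: "card X = card A * card B" unfolding X_def by (simp add: card_image card_cartesian_product)
  have fX: "finite X" unfolding X_def using fA by simp
  \<comment> \<open>A crossing edge of a colour missing in the tree could replace \<open>e\<close>, and then \<open>{w, u}\<close> could be added.\<close>
  have cross: "\<phi> {x, y} \<in> \<phi> ` E" if xy: "x \<in> A" "y \<in> B" for x y
  proof (rule ccontr)
    assume new: "\<phi> {x, y} \<notin> \<phi> ` E"
    let ?E = "insert {x, y} (F \<union> G)"
    have "tree_on S ?E" unfolding sp(4) using sp xy by (intro tree_on.join) auto
    then have "tree_on (S \<union> {u}) (insert {w, u} (?E \<union> {}))"
      using w u by (intro tree_on.join tree_on.single) auto
    moreover have "\<phi> {x, y} \<notin> \<phi> ` (F \<union> G)" "\<phi> {x, y} \<noteq> \<phi> {w, u}"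
      using new e sp(8) by (auto simp: image_iff)
    then have "inj_on \<phi> ?E" "\<phi> {w, u} \<notin> \<phi> ` ?E"
      using cFG inj_on_insertI[OF iFG] by simp_all
    then have "inj_on \<phi> (insert {w, u} (?E \<union> {}))" using inj_on_insertI[of \<phi> ?E] by simp
    ultimately have "card (S \<union> {u}) \<le> card S"
      using maximal[of "S \<union> {u}"] u SW unfolding rainbow_tree_def by auto
    then show False using u finS by simp
  qed
  let ?K = "edges (complete_graph S)"
  have fK: "finite ?K" using finS by simp
  have cK: "card ?K = card S choose 2" using n_subsets[OF finS, of 2] by simp
  have eX: "e \<in> X" unfolding X_def using sp by auto
  have XK: "X \<subseteq> ?K"
  proof
    fix g assume "g \<in> X"
    then obtain x y where "g = {x, y}" "x \<in> A" "y \<in> B" unfolding X_def by auto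
    moreover from this have "x \<noteq> y" using sp(3) by blast
    ultimately show "g \<in> ?K" using sp(4) by simp
  qed
  have EK: "E \<subseteq> ?K" using tree_on_edges[OF E(1)] by auto
  have "{x, y} \<notin> F \<union> G" if "x \<in> A" "y \<in> B" for x y
  proof
    assume "{x, y} \<in> F \<union> G"
    then have "{x, y} \<subseteq> A \<or> {x, y} \<subseteq> B" using FA GB by (metis UnE)
    then show False using that sp(3) by auto
  qed
  then have "X \<inter> E \<subseteq> {e}" unfolding X_def sp(8) by auto
  then have EX: "E \<subseteq> ?K - (X - {e})" using EK by blast
  \<comment> \<open>The tree avoids \<open>X - {e}\<close>, so the colors of crossing edges survive
    its removal.\<close>
  have "\<phi> ` ?K \<subseteq> \<phi> ` (?K - (X - {e}))"
  proof
    fix c assume "c \<in> \<phi> ` ?K"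
    then obtain g where g: "g \<in> ?K" "c = \<phi> g" by blast
    show "c \<in> \<phi> ` (?K - (X - {e}))"
    proof (cases "g \<in> X")
      case True
      then have "c \<in> \<phi> ` E" using cross g(2) unfolding X_def by auto
      then show ?thesis using EX by blast
    next
      case False
      then show ?thesis using g by blast
    qed
  qed
  then have "card (\<phi> ` ?K) \<le> card (?K - (X - {e}))"
    using fK by (meson card_image_le card_mono finite_Diff finite_imageI le_trans)
  also have "\<dots> = (card S choose 2) - (card A * card B - 1)"
    using XK fX eX cX cK by (subst card_Diff_subset) auto
  finally have "card (\<phi> ` ?K) \<le> (card S choose 2) - (card A * card B - 1)" .
  \<comment> \<open>These two bounds rule out truncation in the natural subtractions.\<close>
  moreover have "card A * card B \<le> card S choose 2"
    using card_mono[OF fK XK] cX cK by simp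
  moreover have "1 \<le> card A * card B" using fA by (simp add: Suc_le_eq card_gt_0_iff)
  ultimately have "card (\<phi> ` ?K) + card A * card B \<le> (card S choose 2) + 1" by linarith
  moreover have "inj_on \<phi> F" "\<phi> {w, u} \<notin> \<phi> ` F" using iFG cFG by (auto simp: inj_on_Un)
  moreover have "\<exists>e. E = insert e (F \<union> G)" using sp(8) by blast
  ultimately show ?thesis using that[OF sp(1-5)] by blast
qed

text \<open>The two sides satisfy |A||B| >= k - 1 with k = \<open>card S\<close>, and binom(k,2) -
  (k-1) = binom(k-1,2).\<close>

lemma card_colors_le:
  assumes "S \<noteq> W"
  shows "card (\<phi> ` edges (complete_graph S)) \<le> ((card S - 1) choose 2) + 1"
proof -
  obtain w u where wu: "w \<in> S" "u \<in> W - S"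
    using assms SW tree tree_on_edges unfolding rainbow_tree_def by blast
  obtain A B F G where sp: "tree_on A F" "tree_on B G" "A \<inter> B = {}" "S = A \<union> B"
    "card (\<phi> ` edges (complete_graph S)) + card A * card B \<le> (card S choose 2) + 1"
    using split_at_leaving_edge[OF wu] by metis
  have AB: "1 \<le> card A" "1 \<le> card B" "card S = card A + card B"
    using tree_on_edges[OF sp(1)] tree_on_edges[OF sp(2)] sp(3,4)
    by (auto simp: Suc_le_eq card_gt_0_iff card_Un_disjoint)
  have "card S choose 2 = ((card S - 1) choose 2) + (card S - 1)"
    using choose_two_pred[of "card S"] AB by simp
  then show ?thesis using sum_le_Suc_prod(1)[OF AB(1,2)] AB(3) sp(5) by linarith
qed

lemma colors_subset:
  "\<phi> ` edges (complete_graph W) \<subseteq>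
    \<phi> ` edges (complete_graph S) \<union> \<phi> ` edges (complete_graph (W - S))"
proof
  fix c assume "c \<in> \<phi> ` edges (complete_graph W)"
  then obtain e where e: "c = \<phi> e" "e \<subseteq> W" "card e = 2" by auto
  then obtain a b where "e = {a, b}" "a \<noteq> b" by (auto simp: card_2_iff)
  with e have ab: "c = \<phi> {a, b}" "a \<noteq> b" "a \<in> W" "b \<in> W" by auto
  have inside: "\<phi> {a, b} \<in> \<phi> ` edges (complete_graph X)" if "a \<in> X" "b \<in> X" for X
    using that ab(2) by (intro imageI) simp
  have leave: "\<phi> {x, y} \<in> \<phi> ` edges (complete_graph S)" if "x \<in> S" "y \<in> W - S" for x y
    using leaving_color[OF that] tree tree_on_edges[of S E]
    unfolding rainbow_tree_def edges_complete_graph by blast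
  show "c \<in> \<phi> ` edges (complete_graph S) \<union> \<phi> ` edges (complete_graph (W - S))"
  proof (cases "a \<in> S"; cases "b \<in> S")
    assume "a \<in> S" "b \<in> S"
    then show ?thesis using ab inside by blast
  next
    assume "a \<in> S" "b \<notin> S"
    then show ?thesis using ab leave[of a b] by simp
  next
    assume "a \<notin> S" "b \<in> S"
    then show ?thesis using ab leave[of b a] by (simp add: insert_commute)
  next
    assume "a \<notin> S" "b \<notin> S"
    then show ?thesis using ab inside by blast
  qed
qed

\<comment> \<open>Otherwise every colour of an edge leaving \<open>S\<close> belongs to a pendant edge of the tree; trading that
  leaf for an edge outside \<open>S\<close>, attached at a branching vertex, enlarges the tree.\<close>
lemma outside_colors_subset:
  assumes "3 \<le> card S"
    and "((card S - 1) choose 2) + 1 \<le> card (\<phi> ` edges (complete_graph S))"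
  shows "\<phi> ` edges (complete_graph (W - S)) \<subseteq> \<phi> ` edges (complete_graph S)"
proof (rule ccontr)
  assume "\<not> ?thesis"
  then obtain g where g: "g \<subseteq> W - S" "card g = 2" "\<phi> g \<notin> \<phi> ` edges (complete_graph S)"
    by auto
  then obtain u v where uv: "g = {u, v}" "u \<noteq> v" by (auto simp: card_2_iff)
  obtain w e e' where w: "w \<in> S" "e \<in> E" "e' \<in> E" "e \<noteq> e'" "w \<in> e" "w \<in> e'"
    using tree_on_branching[of S E] tree assms(1) unfolding rainbow_tree_def by blast
  have u: "u \<in> W - S" "v \<in> W - S" using g uv by auto
  obtain A B F G where sp: "tree_on A F" "tree_on B G" "A \<inter> B = {}" "S = A \<union> B" "w \<in> A"
    "inj_on \<phi> F" "\<phi> {w, u} \<notin> \<phi> ` F" "\<exists>e. E = insert e (F \<union> G)"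
    "card (\<phi> ` edges (complete_graph S)) + card A * card B \<le> (card S choose 2) + 1"
    using split_at_leaving_edge[OF w(1) u(1)] by metis
  have AB: "1 \<le> card A" "1 \<le> card B" "card S = card A + card B"
    using tree_on_edges[OF sp(1)] tree_on_edges[OF sp(2)] sp(3,4)
    by (auto simp: Suc_le_eq card_gt_0_iff card_Un_disjoint)
  have FA: "\<forall>e\<in>F. e \<subseteq> A \<and> card e = 2" and GB: "\<forall>e\<in>G. e \<subseteq> B \<and> card e = 2"
    using tree_on_edges[OF sp(1)] tree_on_edges[OF sp(2)] by auto
  \<comment> \<open>Both edges contain \<open>w\<close>, which is not in \<open>B\<close>, and at
    most one of them was deleted.\<close>
  have "e \<in> F \<or> e' \<in> F" using w sp GB by blast
  then obtain h where "h \<subseteq> A" "card h = 2" using FA by blast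
  then have A2: "2 \<le> card A" using card_mono[of A h] tree_on_edges[OF sp(1)] by simp
  have "card S choose 2 = ((card S - 1) choose 2) + (card S - 1)"
    using choose_two_pred[of "card S"] AB by simp
  \<comment> \<open>Equality in the color count leaves just one leaf in \<open>B\<close>.\<close>
  then have "card A * card B \<le> card A + card B - 1" using assms(2) sp(9) AB by linarith
  then have B: "card B = 1" using sum_le_Suc_prod(2)[OF AB(1,2) A2] by simp
  \<comment> \<open>One leaf is given up and two vertices are gained. The color of
    \<open>{w, u}\<close> is free in \<open>F\<close>, and that of \<open>{u, v}\<close> does not
    occur inside \<open>S\<close>.\<close>
  have "tree_on (A \<union> {u, v}) (insert {w, u} (F \<union> {{u, v}}))"
    using sp(1,4,5) u rainbow_tree_pair[OF uv(2), of \<phi>]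
    by (intro tree_on.join) (auto simp: rainbow_tree_def)
  moreover have "inj_on \<phi> (insert {w, u} (F \<union> {{u, v}}))"
  proof -
    have "\<phi> {w, u} \<in> \<phi> ` edges (complete_graph S)"
      using leaving_color[OF w(1) u(1)] tree tree_on_edges[of S E]
      unfolding rainbow_tree_def edges_complete_graph by blast
    moreover have "\<phi> ` F \<subseteq> \<phi> ` edges (complete_graph S)" using FA sp(4) by auto
    ultimately show ?thesis using g(3) sp(6,7) unfolding uv(1) by (auto simp: image_iff)
  qed
  ultimately have "card (A \<union> {u, v}) \<le> card S"
    using maximal[of "A \<union> {u, v}"] u SW sp(4) unfolding rainbow_tree_def by blast
  moreover have "card (A \<union> {u, v}) = card A + 2"
    using u uv sp(4) tree_on_edges[OF sp(1)] by (subst card_Un_disjoint) auto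
  ultimately show False using AB(3) B by simp
qed

end

lemma ex_maximal_rainbow_tree:
  assumes "finite W" "rainbow_tree \<phi> S\<^sub>0 E\<^sub>0" "S\<^sub>0 \<subseteq> W"
  obtains S E where "maximal_rainbow_tree \<phi> W S E" "card S\<^sub>0 \<le> card S"
proof -
  let ?P = "\<lambda>k. \<exists>S E. rainbow_tree \<phi> S E \<and> S \<subseteq> W \<and> card S = k"
  have P0: "?P (card S\<^sub>0)" using assms by blast
  have bd: "k \<le> card W" if "?P k" for k using that assms(1) card_mono by blast
  obtain S E where SE: "rainbow_tree \<phi> S E" "S \<subseteq> W" "card S = Greatest ?P"
    using GreatestI_nat[of ?P, OF P0 bd] by blast
  have "card S' \<le> card S" if "rainbow_tree \<phi> S' E'" "S' \<subseteq> W" for S' E'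
    unfolding SE(3) using that by (intro Greatest_le_nat[of ?P _ "card W"] bd) blast+
  then have "maximal_rainbow_tree \<phi> W S E" using SE assms(1) by unfold_locales
  moreover have "card S\<^sub>0 \<le> card S" unfolding SE(3) using P0 by (intro Greatest_le_nat[of ?P _ "card W"] bd)
  ultimately show ?thesis using that by blast
qed

section \<open>Upper bound\<close>

text \<open>Only a lower bound on the number of colors is assumed and \<open>t\<close> varies, so
  the statement passes to \<open>W - S\<close>. The conclusion is the integer form of card P <=
  ceiling((|W| - t)/2).\<close>

lemma partition_upper_bound:
  assumes "finite W" "(t choose 2) + 2 \<le> card (\<phi> ` edges (complete_graph W))"
  shows "\<exists>P. heterochromatic_tree_partition (complete_graph W) \<phi> P \<and> 2 * card P + t \<le> card W + 1"
  using assms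
proof (induction "card W" arbitrary: W t rule: less_induct)
  case less
  let ?C = "\<lambda>V. \<phi> ` edges (complete_graph V)"
  have finC: "finite (?C V)" if "V \<subseteq> W" for V
    using finite_subset[OF that less.prems(1)] by simp
  have "2 \<le> card (?C W)" using less.prems by simp
  then obtain c d where cd: "c \<in> ?C W" "d \<in> ?C W" "c \<noteq> d"
    by (rule two_distinct_elements)
  then obtain e e' where ee: "e \<subseteq> W" "card e = 2" "e' \<subseteq> W" "card e' = 2" "\<phi> e \<noteq> \<phi> e'" by auto
  obtain S\<^sub>0 E\<^sub>0 where S0: "rainbow_tree \<phi> S\<^sub>0 E\<^sub>0" "S\<^sub>0 \<subseteq> W" "3 \<le> card S\<^sub>0"
    using rainbow_tree_three[of _ W, OF ee] by blast
  obtain S E where max: "maximal_rainbow_tree \<phi> W S E" "card S\<^sub>0 \<le> card S"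
    using ex_maximal_rainbow_tree[OF less.prems(1) S0(1,2)] .
  interpret maximal_rainbow_tree \<phi> W S E by fact
  define k where "k = card S"
  have k3: "3 \<le> k" using S0 max k_def by simp
  have cardW: "card W = k + card (W - S)"
    unfolding k_def using SW fin card_mono[OF fin SW] finS by (simp add: card_Diff_subset)
  have extend: ?case
    if Q: "heterochromatic_tree_partition (complete_graph (W - S)) \<phi> Q"
      and le: "2 * card Q + t + 1 \<le> card W" for Q
  proof -
    let ?T = "\<lparr>verts = S, edges = E\<rparr>"
    have "heterochromatic_tree_partition (complete_graph W) \<phi> ({?T} \<union> Q)"
      using partition_Un[OF partition_single[OF tree] Q] SW by (simp add: Un_absorb1)
    moreover have "card ({?T} \<union> Q) \<le> card Q + 1" using card_Un_le[of "{?T}" Q] by simp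
    ultimately show ?thesis using le by (intro exI conjI) auto
  qed
  obtain Q where Q: "heterochromatic_tree_partition (complete_graph (W - S)) \<phi> Q"
    "2 * card Q \<le> card (W - S) + 1" "even (card (W - S)) \<longrightarrow> 2 * card Q \<le> card (W - S)"
    using partition_pairs[of "W - S" \<phi>] fin by blast
  \<comment> \<open>The induction hypothesis gives 2 * card Q + s <= |W| - k + 1, and t + 2 <= s + k
    turns this into the bound demanded by \<open>extend\<close>.\<close>
  have IH: ?case if "(s choose 2) + 2 \<le> card (?C (W - S))" "t + 2 \<le> s + k" for s
  proof -
    have "\<exists>Q. heterochromatic_tree_partition (complete_graph (W - S)) \<phi> Q \<and>
        2 * card Q + s \<le> card (W - S) + 1"
      by (rule less.hyps) (use that(1) fin cardW k3 in simp_all)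
    then obtain Q' where "heterochromatic_tree_partition (complete_graph (W - S)) \<phi> Q'"
      "2 * card Q' + s \<le> card (W - S) + 1"
      by blast
    then show ?thesis using extend[of Q'] that(2) cardW by simp
  qed
  \<comment> \<open>Otherwise there would be more colors than edges.\<close>
  have "t < card W"
  proof (rule ccontr)
    assume "\<not> t < card W"
    then have "card W choose 2 \<le> t choose 2" by (intro choose_two_mono) simp
    moreover have "card (?C W) \<le> card W choose 2"
      using card_image_le[of "edges (complete_graph W)" \<phi>] n_subsets[OF fin, of 2] fin by simp
    ultimately show False using less.prems(2) by linarith
  qed
  consider "t + 2 \<le> k" | "S = W" | "k \<le> t + 1" "S \<noteq> W" by linarith
  then show ?case
  proof cases
    case 1
    then show ?thesis using extend[OF Q(1)] Q(2) cardW by simp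
  next
    case 2
    then show ?thesis using extend[OF Q(1)] Q(3) \<open>t < card W\<close> by simp
  next
    case 3
    have CS: "card (?C S) \<le> ((k - 1) choose 2) + 1" using card_colors_le[OF 3(2)] k_def by simp
    have CW: "card (?C W) \<le> card (?C S \<union> ?C (W - S))"
      by (rule card_mono) (use colors_subset finC[of S] finC[of "W - S"] SW in auto)
    then have CW': "card (?C W) \<le> card (?C S) + card (?C (W - S))"
      using card_Un_le[of "?C S" "?C (W - S)"] by linarith
    \<comment> \<open>The parameter for \<open>W - S\<close> will be b + 1 = t + 2 - k, the smallest
      one that \<open>IH\<close> admits.\<close>
    define b where "b = t + 1 - k"
    have t: "t = (k - 1) + b" using 3 k3 b_def by simp
    show ?thesis
    proof (cases "b = 0")
      case True
      then have kt: "k = t + 1" using t k3 by simp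
      have "(t choose 2) + 1 < card (?C W)" using less.prems(2) by simp
      \<comment> \<open>Here \<open>S\<close> has at most binom(t,2) + 1 colors, so one is missing.
        By \<open>outside_colors_subset\<close> the bound then drops by one, which leaves the two
        colors outside that the parameter 1 requires.\<close>
      then have "\<not> ?C (W - S) \<subseteq> ?C S"
        using CW CS kt by (metis Un_absorb2 add_diff_cancel_right' le_less_trans not_less)
      then have "card (?C S) \<le> t choose 2"
        using outside_colors_subset k3 kt k_def by (metis Suc_eq_plus1 add_diff_cancel_right' not_less_eq_eq)
      then have "2 \<le> card (?C (W - S))" using CW' less.prems(2) by linarith
      then show ?thesis using IH[of 1] kt by (simp add: one_choose_two)
    next
      case False
      \<comment> \<open>At least binom(b,2) + (k-1)*b + 1 colors remain outside. With k >= 3 and b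
        >= 1 this is at least binom(b,2) + 2*b + 1 >= binom(b+1,2) + 2.\<close>
      have "1 * b \<le> (k - 2) * b" using k3 by (intro mult_right_mono) auto
      moreover have "(k - 1) * b = (k - 2) * b + b" using k3 by (cases k) (auto simp: algebra_simps)
      ultimately have "2 * b \<le> (k - 1) * b" by simp
      moreover have "t choose 2 = ((k - 1) choose 2) + (b choose 2) + (k - 1) * b"
        unfolding t by (rule choose_two_add)
      moreover have "(b + 1) choose 2 = (b choose 2) + b" using choose_two_pred[of "b + 1"] by simp
      ultimately have "((b + 1) choose 2) + 2 \<le> card (?C (W - S))"
        using CS CW' less.prems(2) False by linarith
      then show ?thesis using IH[of "b + 1"] t k3 by simp
    qed
  qed
qed

section \<open>Extremal colorings and the lower bound\<close>

text \<open>Enumerate \<open>I\<close> from 0 and merge all indices from \<open>m - 1\<close> on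
  into the value \<open>m\<close>.\<close>

lemma ex_image_eq_interval:
  assumes "finite I" "1 \<le> m" "m \<le> card I"
  shows "\<exists>g :: 'b \<Rightarrow> nat. g ` I = {1..m}"
proof -
  obtain h where h: "bij_betw h I {0..<card I}" using ex_bij_betw_finite_nat[OF assms(1)] by blast
  have "(\<lambda>x. min (h x) (m - 1) + 1) ` I = (\<lambda>i. min i (m - 1) + 1) ` {0..<card I}"
    using h by (metis (no_types, lifting) bij_betw_imp_surj_on image_cong image_image)
  also have "\<dots> = {1..m}"
  proof
    show "{1..m} \<subseteq> (\<lambda>i. min i (m - 1) + 1) ` {0..<card I}"
    proof
      fix j assume "j \<in> {1..m}"
      then show "j \<in> (\<lambda>i. min i (m - 1) + 1) ` {0..<card I}"
        using assms by (intro image_eqI[of _ _ "j - 1"]) auto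
    qed
  qed (use assms in auto)
  finally show ?thesis by blast
qed

lemma graph_connected_crossing:
  assumes "graph_connected T" "u \<in> verts T" "v \<in> verts T" "u \<in> X" "v \<notin> X"
  shows "\<exists>x y. {x, y} \<in> edges T \<and> x \<in> X \<and> y \<notin> X"
proof -
  have "(u, v) \<in> {(x, y). {x, y} \<in> edges T}\<^sup>*"
    using assms by (simp add: graph_connected_def)
  then show ?thesis using assms(4,5) by (induction rule: rtrancl_induct) auto
qed

text \<open>At most one edge of \<open>T\<close> is not inside \<open>A\<close>, since all such
  edges share the color \<open>r\<close>. If \<open>T\<close> has two vertices outside
  \<open>A\<close>, every vertex outside is an end of that edge; the edge then misses
  \<open>A\<close>, so nothing connects it to \<open>A\<close>.\<close>

lemma heterochromatic_tree_outside:
  assumes "finite V" and T: "subgraph T (complete_graph V)" "heterochromatic_tree \<phi> T"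
    and col: "\<And>e. e \<subseteq> V \<Longrightarrow> \<not> e \<subseteq> A \<Longrightarrow> \<phi> e = r"
  shows "card (verts T - A) \<le> 2"
    and "verts T \<inter> A \<noteq> {} \<Longrightarrow> card (verts T - A) \<le> 1"
proof -
  have conn: "graph_connected T" and inj: "inj_on \<phi> (edges T)"
    and wf: "\<And>e. e \<in> edges T \<Longrightarrow> e \<subseteq> V \<and> card e = 2"
    using T by (auto simp: heterochromatic_tree_def is_tree_def subgraph_def)
  have out: "e = e'" if "e \<in> edges T" "e' \<in> edges T" "\<not> e \<subseteq> A" "\<not> e' \<subseteq> A" for e e'
    using col wf inj that by (metis inj_onD)
  have edge: "\<exists>e\<in>edges T. x \<in> e" if "x \<in> verts T" "y \<in> verts T" "x \<noteq> y" for x y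
    using graph_connected_crossing[OF conn that(1,2), of "{x}"] that by auto
  consider x where "verts T - A \<subseteq> {x}" | x y where "x \<in> verts T - A" "y \<in> verts T - A" "x \<noteq> y"
    by blast
  then have "card (verts T - A) \<le> 2 \<and> (verts T \<inter> A \<noteq> {} \<longrightarrow> card (verts T - A) \<le> 1)"
  proof cases
    case (1 x)
    then have "card (verts T - A) \<le> 1" using card_mono[of "{x}"] by simp
    then show ?thesis by simp
  next
    case (2 x y)
    obtain e where e: "e \<in> edges T" "x \<in> e" using edge 2 by blast
    have sub: "verts T - A \<subseteq> e"
    proof
      fix z assume z: "z \<in> verts T - A"
      then obtain e' where "e' \<in> edges T" "z \<in> e'" using edge 2 by (metis Diff_iff)
      then show "z \<in> e" using out[of e e'] e z 2 by blast
    qed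
    have ce: "card e = 2" "finite e" using wf[OF e(1)] by (auto intro: card_ge_0_finite)
    have "{x, y} \<subseteq> e" using sub 2 by blast
    then have exy: "e = {x, y}" using card_subset_eq[of e "{x, y}"] ce 2(3) by simp
    have "card (verts T - A) \<le> 2" using card_mono[OF ce(2) sub] ce by simp
    moreover have "verts T \<inter> A = {}"
    proof (rule ccontr)
      assume "verts T \<inter> A \<noteq> {}"
      then obtain a where "a \<in> verts T" "a \<in> A" by blast
      then obtain p q where pq: "{p, q} \<in> edges T" "p \<in> A" "q \<notin> A"
        using graph_connected_crossing[OF conn, of a x A] 2 by blast
      then have "{p, q} = e" using out[of "{p, q}" e] e 2 by blast
      then show False using exy pq 2 by auto
    qed
    ultimately show ?thesis by simp
  qed
  then show "card (verts T - A) \<le> 2"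
    and "verts T \<inter> A \<noteq> {} \<Longrightarrow> card (verts T - A) \<le> 1" by auto
qed

text \<open>Each tree covers at most two vertices outside \<open>A\<close>, and a tree meeting
  \<open>A\<close> at most one. Singling out one tree of the latter kind gives |V - A| <= 2|P| -
  1.\<close>

lemma partition_lower_bound:
  assumes "finite V" "A \<subseteq> V" "A \<noteq> {}"
    and col: "\<And>e. e \<subseteq> V \<Longrightarrow> \<not> e \<subseteq> A \<Longrightarrow> \<phi> e = r"
    and P: "heterochromatic_tree_partition (complete_graph V) \<phi> P"
  shows "card V + 1 \<le> 2 * card P + card A"
proof -
  have fP: "finite P" and U: "(\<Union>T\<in>P. verts T) = V"
    and T: "\<And>T. T \<in> P \<Longrightarrow> subgraph T (complete_graph V) \<and> heterochromatic_tree \<phi> T"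
    using P by (simp_all add: heterochromatic_tree_partition_def)
  have o: "card (verts T - A) \<le> 2" "verts T \<inter> A \<noteq> {} \<Longrightarrow> card (verts T - A) \<le> 1"
    if "T \<in> P" for T
    using heterochromatic_tree_outside[OF assms(1), of T \<phi> A r] T[OF that] col by blast+
  obtain a where "a \<in> A" using assms by blast
  then obtain T where T0: "T \<in> P" "verts T \<inter> A \<noteq> {}" using U assms(2) by blast
  have "V - A = (\<Union>T\<in>P. verts T - A)" using U by blast
  then have "card (V - A) \<le> (\<Sum>T\<in>P. card (verts T - A))" using card_UN_le[OF fP] by metis
  also have "\<dots> = card (verts T - A) + (\<Sum>T\<in>P - {T}. card (verts T - A))"
    by (rule sum.remove[OF fP T0(1)])
  also have "\<dots> \<le> 1 + (\<Sum>T\<in>P - {T}. 2)"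
    by (intro add_mono sum_mono o) (use T0 in auto)
  also have "\<dots> = 1 + 2 * (card P - 1)" using fP T0 by simp
  finally have "card (V - A) \<le> 1 + 2 * (card P - 1)" .
  moreover have "1 \<le> card P" using fP T0 by (auto simp: Suc_le_eq card_gt_0_iff)
  moreover have "card V = card A + card (V - A)"
    using assms(1,2) by (metis card_Diff_subset card_mono finite_subset le_add_diff_inverse)
  ultimately show ?thesis by linarith
qed

lemma ex_extremal_coloring:
  assumes "finite V" "2 \<le> r" "r \<le> card V choose 2" "r \<le> ((t + 1) choose 2) + 1" "t < card V"
  shows "\<exists>\<phi>. edge_coloring r (complete_graph V) \<phi> \<and>
    (\<forall>P. heterochromatic_tree_partition (complete_graph V) \<phi> P \<longrightarrow> card V \<le> 2 * card P + t)"
proof (cases "t + 1 = card V")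
  \<comment> \<open>Here a set of t + 1 vertices is all of \<open>V\<close>, and no edge would be
    left for the color \<open>r\<close>. The claim reduces to \<open>1 \<le> card P\<close>, so any
    coloring serves.\<close>
  case True
  have "\<exists>\<phi>. edge_coloring r (complete_graph V) \<phi>"
    unfolding edge_coloring_def using assms n_subsets[OF assms(1), of 2]
    by (intro ex_image_eq_interval) simp_all
  moreover have "1 \<le> card P" if "heterochromatic_tree_partition (complete_graph V) \<phi> P" for \<phi> P
    using that assms(5) by (auto simp: heterochromatic_tree_partition_def Suc_le_eq card_gt_0_iff)
  ultimately show ?thesis using True by fastforce
next
  case False
  obtain A where A: "A \<subseteq> V" "card A = t + 1"
    using assms(5) obtain_subset_with_card_n[of "t + 1" V] by auto
  have fA: "finite A" "A \<noteq> {}" using A assms(1) finite_subset by auto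
  let ?I = "edges (complete_graph A)"
  have "card ?I = (t + 1) choose 2" using n_subsets[OF fA(1), of 2] A(2) by simp
  \<comment> \<open>The bound on \<open>r\<close> ensures that \<open>A\<close> has at least
    \<open>r - 1\<close> edges.\<close>
  then have "\<exists>g :: 'a set \<Rightarrow> nat. g ` ?I = {1..r - 1}"
    using fA(1) assms(2,4) by (intro ex_image_eq_interval) simp_all
  then obtain g :: "'a set \<Rightarrow> nat" where g: "g ` ?I = {1..r - 1}" by blast
  define \<phi> where "\<phi> e = (if e \<subseteq> A then g e else r)" for e
  have "A \<noteq> V" using A False by auto
  then obtain a x where ax: "a \<in> A" "x \<in> V" "x \<notin> A" using A fA by blast
  have "\<phi> ` edges (complete_graph V) = {1..r}"
  proof
    have "\<phi> e \<in> {1..r}" if "e \<subseteq> V" "card e = 2" for e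
    proof (cases "e \<subseteq> A")
      case True
      then have "g e \<in> {1..r - 1}" using g that by auto
      then show ?thesis using True by (auto simp: \<phi>_def)
    qed (use assms(2) in \<open>simp add: \<phi>_def\<close>)
    then show "\<phi> ` edges (complete_graph V) \<subseteq> {1..r}" by auto
    have "\<phi> ` ?I = {1..r - 1}" using g by (simp add: \<phi>_def)
    moreover have "\<phi> ` ?I \<subseteq> \<phi> ` edges (complete_graph V)" using A(1) by auto
    moreover have "r = \<phi> {a, x}" "{a, x} \<in> edges (complete_graph V)"
      using ax A(1) by (auto simp: \<phi>_def card_2_iff)
    then have "r \<in> \<phi> ` edges (complete_graph V)" by blast
    moreover have "{1..r} = insert r {1..r - 1}" using assms(2) by auto
    ultimately show "{1..r} \<subseteq> \<phi> ` edges (complete_graph V)" by blast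
  qed
  moreover have "card V \<le> 2 * card P + t"
    if "heterochromatic_tree_partition (complete_graph V) \<phi> P" for P
    using partition_lower_bound[OF assms(1) A(1) fA(2), of \<phi> r P] that A(2) by (simp add: \<phi>_def)
  ultimately show ?thesis unfolding edge_coloring_def by blast
qed

section \<open>The function \<open>f\<close> and the exact value\<close>

text \<open>The greatest \<open>t\<close> satisfying the left inequality satisfies the right one,
  because \<open>t + 1\<close> violates the left one. Uniqueness is \<open>un\<close> applied in
  both directions.\<close>

lemma f_bounds:
  assumes "2 \<le> r"
  shows "0 < f r \<and> ((f r) choose 2) + 2 \<le> r \<and> r \<le> ((f r + 1) choose 2) + 1"
proof -
  let ?Q = "\<lambda>t. (t choose 2) + 2 \<le> r"
  define t where "t = Greatest ?Q"
  have step: "Suc t choose 2 = (t choose 2) + t" for t :: nat using choose_two_pred[of "Suc t"] by simp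
  have big: "t \<le> (t choose 2) + 1" for t :: nat by (induction t) (use step in auto)
  have bd: "s \<le> r" if "?Q s" for s using big[of s] that by linarith
  have "?Q 1" using assms by (simp add: one_choose_two)
  then have "?Q t" unfolding t_def by (rule GreatestI_nat[where b = r]) (rule bd)
  moreover have le: "s \<le> t" if "?Q s" for s unfolding t_def by (rule Greatest_le_nat[where P = ?Q and b = r]) (use that bd in blast)+
  moreover have "\<not> ?Q (t + 1)"
  proof
    assume "?Q (t + 1)"
    then show False using le by fastforce
  qed
  moreover have "1 \<le> t" using le \<open>?Q 1\<close> by blast
  ultimately have ex: "0 < t \<and> (t choose 2) + 2 \<le> r \<and> r \<le> ((t + 1) choose 2) + 1" by linarith
  have un: "s \<le> s'" if "(s choose 2) + 2 \<le> r" "r \<le> ((s' + 1) choose 2) + 1" for s s' :: nat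
  proof (rule ccontr)
    assume "\<not> s \<le> s'"
    then have "(s' + 1) choose 2 \<le> s choose 2" by (intro choose_two_mono) simp
    then show False using that by linarith
  qed
  show ?thesis unfolding f_def
    by (rule theI[of _ t]) (use ex un in \<open>auto intro: order_antisym\<close>)
qed

theorem theorem1:
  fixes n r t :: nat and V :: "'a set"
  assumes "3 \<le> n" and "2 \<le> r" and "r \<le> n choose 2"
    and "t = f r"
    and "finite V" and "card V = n"
  shows "int (heterochromatic_tree_partition_number r (complete_graph V))
           = \<lceil>(real n - real t) / 2\<rceil>"
proof -
  let ?K = "complete_graph V"
  have t: "1 \<le> t" "(t choose 2) + 2 \<le> r" "r \<le> ((t + 1) choose 2) + 1"
    using f_bounds[OF assms(2)] assms(4) by auto
  have "t < n"
  proof (rule ccontr)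
    assume "\<not> t < n"
    then have "n choose 2 \<le> t choose 2" by (intro choose_two_mono) simp
    then show False using t assms(3) by linarith
  qed
  let ?h = "heterochromatic_tree_partition_number r ?K"
  \<comment> \<open>The ceiling of (n - t)/2 in natural numbers, where \<open>t < n\<close> makes
    the subtraction exact.\<close>
  define M where "M = (n - t + 1) div 2"
  \<comment> \<open>The partition from the upper bound also shows that the \<open>LEAST\<close> is
    attained, so the lower bound for \<open>\<psi>\<close> applies to an actual partition.\<close>
  have upper: "min_heterochromatic_trees ?K \<phi> \<le> M"
    and attained: "\<exists>P. heterochromatic_tree_partition ?K \<phi> P \<and> card P = min_heterochromatic_trees ?K \<phi>"
    if "edge_coloring r ?K \<phi>" for \<phi>
  proof -
    have "card (\<phi> ` edges ?K) = r" using that by (simp add: edge_coloring_def)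
    then obtain P where P: "heterochromatic_tree_partition ?K \<phi> P" "2 * card P + t \<le> n + 1"
      using partition_upper_bound[OF assms(5), of t \<phi>] t(2) assms(6) by auto
    show "min_heterochromatic_trees ?K \<phi> \<le> M"
      unfolding min_heterochromatic_trees_def
      by (rule order_trans[OF Least_le[of _ "card P"]]) (use P M_def in auto)
    show "\<exists>P. heterochromatic_tree_partition ?K \<phi> P \<and> card P = min_heterochromatic_trees ?K \<phi>"
      unfolding min_heterochromatic_trees_def by (rule LeastI[of _ "card P"]) (use P in blast)
  qed
  obtain \<psi> where \<psi>: "edge_coloring r ?K \<psi>"
    "\<And>P. heterochromatic_tree_partition ?K \<psi> P \<Longrightarrow> n \<le> 2 * card P + t"
    using ex_extremal_coloring[OF assms(5,2) _ t(3)] assms(3,6) \<open>t < n\<close> by blast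
  have "M \<le> min_heterochromatic_trees ?K \<psi>"
    using attained[OF \<psi>(1)] \<psi>(2) unfolding M_def by fastforce
  then have "min_heterochromatic_trees ?K \<psi> = M" using upper[OF \<psi>(1)] by simp
  then have "?h = M"
    unfolding heterochromatic_tree_partition_number_def
    by (intro Max_eqI) (use upper \<psi>(1) in \<open>auto intro!: finite_subset[of _ "{..M}"]\<close>)
  moreover have "\<lceil>(real n - real t) / 2\<rceil> = int M"
  proof -
    define d where "d = n - t"
    have "real n - real t = real d" using \<open>t < n\<close> d_def by simp
    moreover have "\<lceil>real d / 2\<rceil> = int ((d + 1) div 2)"
      by (cases "even d") (auto elim!: evenE oddE intro!: ceiling_unique)
    ultimately show ?thesis by (simp only: M_def d_def)
  qed
  ultimately show ?thesis by simp
qed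

end
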